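(* Let $\mathcal{C}=(\mathcal{C},\otimes,I,c)$ and $\mathcal{D}=(\mathcal{D},\odot,J,c')$ be additive symmetric strict monoidal categories and let $(F,\Psi_0,\Psi):\mathcal{C}\to\mathcal{D}$ be an additive symmetric monoidal functor. If $(L,[-,-])$ is a Lie algebra in $\mathcal{C}$, then $(FL,F([-,-])\circ\Psi_{L,L})$ is a Lie algebra in $\mathcal{D}$.
   Context: "Strict" means that the associativity and unit constraints are identities; the symmetries $c_{X,Y}:X\otimes Y\to Y\otimes X$ and $c'$ are arbitrary symmetries. A symmetric monoidal functor $(F,\Psi_0,\Psi):\mathcal{C}\to\mathcal{D}$ is a (lax) monoidal functor, with structure morphism $\Psi_0:J\to FI$ and natural transformation $\Psi_{X,Y}:FX\odot FY\to F(X\otimes Y)$ (not required to be invertible) satisfying the usual associativity and unit coherence conditions, and compatible with the symmetries: $\Psi_{Y,X}\circ c'_{FX,FY}=F(c_{X,Y})\circ\Psi_{X,Y}$ for all $X,Y\in\mathcal{C}$. It is additive if the functor $F$ is additive. A Lie algebra in an additive symmetric strict monoidal category $(\mathcal{C},\otimes,I,c)$ is a pair $(L,[-,-])$ where $L$ is an object of $\mathcal{C}$ and $[-,-]:L\otimes L\to L$ is a morphism in $\mathcal{C}$ such that $$[-,-]\circ(\mathrm{id}_{L\otimes L}+c_{L,L})=0,\qquad [-,-]\circ(\mathrm{id}_L\otimes[-,-])\circ(\mathrm{id}_{L\otimes L\otimes L}+t+w)=0,$$ where $t=c_{L\otimes L,L}$ and $w=c_{L,L\otimes L}$, viewed as endomorphisms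 of $L\otimes L\otimes L$. *)

theory Defs
  imports "HOL-Algebra.Group"
begin

section \<open>Categories\<close>

text \<open>Operations are total functions on the underlying types; only their values on objects,
  on arrows, and on composable or parallel arrows are meaningful.\<close>

record ('o, 'a) category_data =
  ob :: "'o set"
  ar :: "'a set"
  source :: "'a \<Rightarrow> 'o"
  target :: "'a \<Rightarrow> 'o"
  ide :: "'o \<Rightarrow> 'a"
  comp :: "'a \<Rightarrow> 'a \<Rightarrow> 'a" (infixr "\<cdot>\<index>" 68)

definition homset :: "('o, 'a, 'm) category_data_scheme \<Rightarrow> 'o \<Rightarrow> 'o \<Rightarrow> 'a set" where
  "homset C X Y = {f \<in> ar C. source C f = X \<and> target C f = Y}"

locale category =
  fixes C :: "('o, 'a, 'm) category_data_scheme" (structure)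
  assumes source_in: "f \<in> ar C \<Longrightarrow> source C f \<in> ob C"
    and target_in: "f \<in> ar C \<Longrightarrow> target C f \<in> ob C"
    and ide_in: "X \<in> ob C \<Longrightarrow> ide C X \<in> homset C X X"
    and comp_in: "\<lbrakk>f \<in> homset C X Y; g \<in> homset C Y Z\<rbrakk> \<Longrightarrow> g \<cdot> f \<in> homset C X Z"
    and comp_ide: "f \<in> homset C X Y \<Longrightarrow> f \<cdot> ide C X = f"
    and ide_comp: "f \<in> homset C X Y \<Longrightarrow> ide C Y \<cdot> f = f"
    and comp_assoc: "\<lbrakk>f \<in> homset C W X; g \<in> homset C X Y; h \<in> homset C Y Z\<rbrakk>
      \<Longrightarrow> (h \<cdot> g) \<cdot> f = h \<cdot> (g \<cdot> f)"

locale "functor" = C: category C + D: category D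
  for C :: "('o, 'a, 'm) category_data_scheme" (structure)
    and D :: "('p, 'b, 'n) category_data_scheme" (structure) +
  fixes Fo :: "'o \<Rightarrow> 'p" and Fa :: "'a \<Rightarrow> 'b"
  assumes Fo_in: "X \<in> ob C \<Longrightarrow> Fo X \<in> ob D"
    and Fa_in: "f \<in> homset C X Y \<Longrightarrow> Fa f \<in> homset D (Fo X) (Fo Y)"
    and Fa_ide: "X \<in> ob C \<Longrightarrow> Fa (ide C X) = ide D (Fo X)"
    and Fa_comp: "\<lbrakk>f \<in> homset C X Y; g \<in> homset C Y Z\<rbrakk>
      \<Longrightarrow> Fa (g \<cdot>\<^bsub>C\<^esub> f) = Fa g \<cdot>\<^bsub>D\<^esub> Fa f"


section \<open>Additive categories\<close>

record ('o, 'a) additive_data = "('o, 'a) category_data" +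
  zero_ar :: "'o \<Rightarrow> 'o \<Rightarrow> 'a"
  add_ar :: "'a \<Rightarrow> 'a \<Rightarrow> 'a" (infixl "\<boxplus>\<index>" 65)

definition hom_group :: "('o, 'a, 'm) additive_data_scheme \<Rightarrow> 'o \<Rightarrow> 'o \<Rightarrow> 'a monoid" where
  "hom_group C X Y = \<lparr>carrier = homset C X Y, mult = add_ar C, one = zero_ar C X Y\<rparr>"

definition zero_object :: "('o, 'a, 'm) category_data_scheme \<Rightarrow> 'o \<Rightarrow> bool" where
  "zero_object C Z \<longleftrightarrow> Z \<in> ob C \<and>
     (\<forall>X \<in> ob C. (\<exists>!f. f \<in> homset C X Z) \<and> (\<exists>!f. f \<in> homset C Z X))"

definition biproduct ::
  "('o, 'a, 'm) additive_data_scheme \<Rightarrow> 'o \<Rightarrow> 'o \<Rightarrow> 'o \<Rightarrow> 'a \<Rightarrow> 'a \<Rightarrow> 'a \<Rightarrow> 'a \<Rightarrow> bool" where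
  "biproduct C X Y P i j p q \<longleftrightarrow> P \<in> ob C \<and>
     i \<in> homset C X P \<and> j \<in> homset C Y P \<and> p \<in> homset C P X \<and> q \<in> homset C P Y \<and>
     p \<cdot>\<^bsub>C\<^esub> i = ide C X \<and> q \<cdot>\<^bsub>C\<^esub> j = ide C Y \<and>
     q \<cdot>\<^bsub>C\<^esub> i = zero_ar C X Y \<and> p \<cdot>\<^bsub>C\<^esub> j = zero_ar C Y X \<and>
     (i \<cdot>\<^bsub>C\<^esub> p) \<boxplus>\<^bsub>C\<^esub> (j \<cdot>\<^bsub>C\<^esub> q) = ide C P"

locale additive_category = category C
  for C :: "('o, 'a, 'm) additive_data_scheme" (structure) +
  assumes hom_comm_group: "\<lbrakk>X \<in> ob C; Y \<in> ob C\<rbrakk> \<Longrightarrow> comm_group (hom_group C X Y)"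
    and comp_add_left: "\<lbrakk>f \<in> homset C X Y; g \<in> homset C Y Z; h \<in> homset C Y Z\<rbrakk>
      \<Longrightarrow> (g \<boxplus> h) \<cdot> f = (g \<cdot> f) \<boxplus> (h \<cdot> f)"
    and comp_add_right: "\<lbrakk>f \<in> homset C X Y; g \<in> homset C X Y; h \<in> homset C Y Z\<rbrakk>
      \<Longrightarrow> h \<cdot> (f \<boxplus> g) = (h \<cdot> f) \<boxplus> (h \<cdot> g)"
    and ex_zero_object: "\<exists>Z. zero_object C Z"
    and ex_biproduct: "\<lbrakk>X \<in> ob C; Y \<in> ob C\<rbrakk> \<Longrightarrow> \<exists>P i j p q. biproduct C X Y P i j p q"

locale additive_functor = "functor" C D Fo Fa + C: additive_category C + D: additive_category D
  for C :: "('o, 'a, 'm) additive_data_scheme" (structure)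
    and D :: "('p, 'b, 'n) additive_data_scheme" (structure)
    and Fo :: "'o \<Rightarrow> 'p" and Fa :: "'a \<Rightarrow> 'b" +
  assumes Fa_add: "\<lbrakk>f \<in> homset C X Y; g \<in> homset C X Y\<rbrakk>
      \<Longrightarrow> Fa (f \<boxplus>\<^bsub>C\<^esub> g) = Fa f \<boxplus>\<^bsub>D\<^esub> Fa g"


section \<open>Symmetric strict monoidal categories\<close>

record ('o, 'a) monoidal_data = "('o, 'a) additive_data" +
  tensor_ob :: "'o \<Rightarrow> 'o \<Rightarrow> 'o" (infixr "\<boxdot>\<index>" 70)
  tensor_ar :: "'a \<Rightarrow> 'a \<Rightarrow> 'a" (infixr "\<boxtimes>\<index>" 70)
  unit_ob :: "'o"
  symm :: "'o \<Rightarrow> 'o \<Rightarrow> 'a"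

text \<open>The tensor product is a bifunctor; strictness means that it is associative and unital
  on the nose, on objects as well as on arrows.\<close>

locale strict_monoidal_category = category C
  for C :: "('o, 'a, 'm) monoidal_data_scheme" (structure) +
  assumes tensor_ob_in: "\<lbrakk>X \<in> ob C; Y \<in> ob C\<rbrakk> \<Longrightarrow> X \<boxdot> Y \<in> ob C"
    and tensor_ar_in: "\<lbrakk>f \<in> homset C X X'; g \<in> homset C Y Y'\<rbrakk>
      \<Longrightarrow> f \<boxtimes> g \<in> homset C (X \<boxdot> Y) (X' \<boxdot> Y')"
    and tensor_ide: "\<lbrakk>X \<in> ob C; Y \<in> ob C\<rbrakk> \<Longrightarrow> ide C X \<boxtimes> ide C Y = ide C (X \<boxdot> Y)"
    and tensor_comp: "\<lbrakk>f \<in> homset C X X'; f' \<in> homset C X' X'';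
        g \<in> homset C Y Y'; g' \<in> homset C Y' Y''\<rbrakk>
      \<Longrightarrow> (f' \<cdot> f) \<boxtimes> (g' \<cdot> g) = (f' \<boxtimes> g') \<cdot> (f \<boxtimes> g)"
    and unit_ob_in: "unit_ob C \<in> ob C"
    and tensor_ob_assoc: "\<lbrakk>X \<in> ob C; Y \<in> ob C; Z \<in> ob C\<rbrakk>
      \<Longrightarrow> (X \<boxdot> Y) \<boxdot> Z = X \<boxdot> (Y \<boxdot> Z)"
    and tensor_ob_unit_left: "X \<in> ob C \<Longrightarrow> unit_ob C \<boxdot> X = X"
    and tensor_ob_unit_right: "X \<in> ob C \<Longrightarrow> X \<boxdot> unit_ob C = X"
    and tensor_ar_assoc: "\<lbrakk>f \<in> ar C; g \<in> ar C; h \<in> ar C\<rbrakk>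
      \<Longrightarrow> (f \<boxtimes> g) \<boxtimes> h = f \<boxtimes> (g \<boxtimes> h)"
    and tensor_ar_unit_left: "f \<in> ar C \<Longrightarrow> ide C (unit_ob C) \<boxtimes> f = f"
    and tensor_ar_unit_right: "f \<in> ar C \<Longrightarrow> f \<boxtimes> ide C (unit_ob C) = f"

text \<open>Invertibility of the symmetry is part of \<open>symm_inverse\<close>; the second hexagon
  follows from \<open>symm_hexagon\<close> and \<open>symm_inverse\<close>.\<close>

locale symmetric_strict_monoidal_category = strict_monoidal_category C
  for C :: "('o, 'a, 'm) monoidal_data_scheme" (structure) +
  assumes symm_in: "\<lbrakk>X \<in> ob C; Y \<in> ob C\<rbrakk> \<Longrightarrow> symm C X Y \<in> homset C (X \<boxdot> Y) (Y \<boxdot> X)"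
    and symm_natural: "\<lbrakk>f \<in> homset C X X'; g \<in> homset C Y Y'\<rbrakk>
      \<Longrightarrow> symm C X' Y' \<cdot> (f \<boxtimes> g) = (g \<boxtimes> f) \<cdot> symm C X Y"
    and symm_inverse: "\<lbrakk>X \<in> ob C; Y \<in> ob C\<rbrakk>
      \<Longrightarrow> symm C Y X \<cdot> symm C X Y = ide C (X \<boxdot> Y)"
    and symm_hexagon: "\<lbrakk>X \<in> ob C; Y \<in> ob C; Z \<in> ob C\<rbrakk>
      \<Longrightarrow> symm C X (Y \<boxdot> Z) = (ide C Y \<boxtimes> symm C X Z) \<cdot> (symm C X Y \<boxtimes> ide C Z)"

text \<open>The tensor product is not required to be biadditive: the category is additive and it
  is symmetric strict monoidal.  Categories with a biadditive tensor product are covered.\<close>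

locale additive_symmetric_strict_monoidal_category =
  additive_category C + symmetric_strict_monoidal_category C
  for C :: "('o, 'a, 'm) monoidal_data_scheme" (structure)


section \<open>Symmetric monoidal functors\<close>

text \<open>These are lax: neither \<open>\<Psi>\<^sub>0\<close> nor \<open>\<Psi>\<close> need be invertible.\<close>

locale symmetric_monoidal_functor = "functor" C D Fo Fa +
  C: symmetric_strict_monoidal_category C + D: symmetric_strict_monoidal_category D
  for C :: "('o, 'a, 'm) monoidal_data_scheme" (structure)
    and D :: "('p, 'b, 'n) monoidal_data_scheme" (structure)
    and Fo :: "'o \<Rightarrow> 'p" and Fa :: "'a \<Rightarrow> 'b" +
  fixes \<Psi>\<^sub>0 :: 'b and \<Psi> :: "'o \<Rightarrow> 'o \<Rightarrow> 'b"
  assumes Psi0_in: "\<Psi>\<^sub>0 \<in> homset D (unit_ob D) (Fo (unit_ob C))"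
    and Psi_in: "\<lbrakk>X \<in> ob C; Y \<in> ob C\<rbrakk>
      \<Longrightarrow> \<Psi> X Y \<in> homset D (Fo X \<boxdot>\<^bsub>D\<^esub> Fo Y) (Fo (X \<boxdot>\<^bsub>C\<^esub> Y))"
    and Psi_natural: "\<lbrakk>f \<in> homset C X X'; g \<in> homset C Y Y'\<rbrakk>
      \<Longrightarrow> \<Psi> X' Y' \<cdot>\<^bsub>D\<^esub> (Fa f \<boxtimes>\<^bsub>D\<^esub> Fa g) = Fa (f \<boxtimes>\<^bsub>C\<^esub> g) \<cdot>\<^bsub>D\<^esub> \<Psi> X Y"
    and Psi_assoc: "\<lbrakk>X \<in> ob C; Y \<in> ob C; Z \<in> ob C\<rbrakk>
      \<Longrightarrow> \<Psi> (X \<boxdot>\<^bsub>C\<^esub> Y) Z \<cdot>\<^bsub>D\<^esub> (\<Psi> X Y \<boxtimes>\<^bsub>D\<^esub> ide D (Fo Z))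
        = \<Psi> X (Y \<boxdot>\<^bsub>C\<^esub> Z) \<cdot>\<^bsub>D\<^esub> (ide D (Fo X) \<boxtimes>\<^bsub>D\<^esub> \<Psi> Y Z)"
    and Psi_unit_left: "X \<in> ob C
      \<Longrightarrow> \<Psi> (unit_ob C) X \<cdot>\<^bsub>D\<^esub> (\<Psi>\<^sub>0 \<boxtimes>\<^bsub>D\<^esub> ide D (Fo X)) = ide D (Fo X)"
    and Psi_unit_right: "X \<in> ob C
      \<Longrightarrow> \<Psi> X (unit_ob C) \<cdot>\<^bsub>D\<^esub> (ide D (Fo X) \<boxtimes>\<^bsub>D\<^esub> \<Psi>\<^sub>0) = ide D (Fo X)"
    and Psi_symm: "\<lbrakk>X \<in> ob C; Y \<in> ob C\<rbrakk>
      \<Longrightarrow> \<Psi> Y X \<cdot>\<^bsub>D\<^esub> symm D (Fo X) (Fo Y) = Fa (symm C X Y) \<cdot>\<^bsub>D\<^esub> \<Psi> X Y"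

locale additive_symmetric_monoidal_functor =
  additive_functor C D Fo Fa + symmetric_monoidal_functor C D Fo Fa \<Psi>\<^sub>0 \<Psi>
  for C :: "('o, 'a, 'm) monoidal_data_scheme" (structure)
    and D :: "('p, 'b, 'n) monoidal_data_scheme" (structure)
    and Fo :: "'o \<Rightarrow> 'p" and Fa :: "'a \<Rightarrow> 'b"
    and \<Psi>\<^sub>0 :: 'b and \<Psi> :: "'o \<Rightarrow> 'o \<Rightarrow> 'b"


section \<open>Lie algebras\<close>

text \<open>By strictness, \<open>symm C (L \<boxdot> L) L\<close> and \<open>symm C L (L \<boxdot> L)\<close> are endomorphisms
  of \<open>L \<boxdot> L \<boxdot> L\<close>.\<close>

locale lie_algebra = additive_symmetric_strict_monoidal_category C
  for C :: "('o, 'a, 'm) monoidal_data_scheme" (structure) +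
  fixes L :: 'o and br :: 'a
  assumes L_in: "L \<in> ob C"
    and br_in: "br \<in> homset C (L \<boxdot> L) L"
    and antisymmetry: "br \<cdot> (ide C (L \<boxdot> L) \<boxplus> symm C L L) = zero_ar C (L \<boxdot> L) L"
    and jacobi: "br \<cdot> (ide C L \<boxtimes> br) \<cdot>
        (ide C (L \<boxdot> L \<boxdot> L) \<boxplus> symm C (L \<boxdot> L) L \<boxplus> symm C L (L \<boxdot> L))
      = zero_ar C (L \<boxdot> L \<boxdot> L) L"

end

theory Submission
  imports Defs
begin

text \<open>
  Write \<open>b = F br \<circ> \<Psi>\<close> for the new bracket.  The point is that each Lie algebra axiom is an
  equation \<open>\<beta> \<circ> \<sigma> = 0\<close>, where \<open>\<beta>\<close> is an (iterated) bracket out of a tensor power of \<open>L\<close> and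
  \<open>\<sigma>\<close> is a sum of permutations of the factors.  It is transported as follows.

  The iterated bracket \<open>b \<circ> (id \<odot> b)\<close> factors as \<open>F (br \<circ> (id \<otimes> br)) \<circ> T\<close>, where
  \<open>T = \<Psi> \<circ> (id \<odot> \<Psi>) : FL \<odot> FL \<odot> FL \<rightarrow> F (L \<otimes> L \<otimes> L)\<close>; this is naturality of \<open>\<Psi>\<close>.  The
  comparison arrow \<open>T\<close> intertwines the two cyclic permutations in \<open>D\<close> with the images under \<open>F\<close>
  of those in \<open>C\<close> (lemmas \<open>Psi_symm_tensor_left\<close> and \<open>Psi_symm_tensor_right\<close>).  Each of these
  moves \<open>\<Psi>\<close> past the symmetry of \<open>D\<close> by naturality and then applies compatibility of \<open>\<Psi>\<close> with the
  symmetries; in doing so it turns one bracketing of the three factors into the other, so that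
  associativity of \<open>\<Psi>\<close> is what makes both statements speak about the same \<open>T\<close>.

  Since \<open>F\<close> and composition are additive, \<open>T \<circ> (id + t' + w') = F (id + t + w) \<circ> T\<close>, and the
  Jacobi expression for \<open>b\<close> becomes \<open>F (br \<circ> (id \<otimes> br) \<circ> (id + t + w)) \<circ> T = F 0 \<circ> T = 0\<close>.
  Antisymmetry is the same argument with \<open>\<Psi>\<close> in place of \<open>T\<close>.
\<close>

section \<open>Zero arrows and sums of arrows\<close>

context category
begin

lemma homset_source_in: "f \<in> homset C X Y \<Longrightarrow> X \<in> ob C"
  and homset_target_in: "f \<in> homset C X Y \<Longrightarrow> Y \<in> ob C"
  using source_in target_in by (auto simp: homset_def)

end

context additive_category
begin

lemma add_in:
  assumes "f \<in> homset C X Y" "g \<in> homset C X Y"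
  shows "f \<boxplus> g \<in> homset C X Y"
proof -
  interpret H: comm_group "hom_group C X Y"
    using assms by (intro hom_comm_group homset_source_in homset_target_in)
  show ?thesis
    using H.m_closed[of f g] assms by (simp add: hom_group_def)
qed

lemma zero_in:
  assumes "X \<in> ob C" "Y \<in> ob C"
  shows "zero_ar C X Y \<in> homset C X Y"
proof -
  interpret H: comm_group "hom_group C X Y"
    using assms by (rule hom_comm_group)
  show ?thesis
    using H.one_closed by (simp add: hom_group_def)
qed

lemma zero_add_zero:
  assumes "X \<in> ob C" "Y \<in> ob C"
  shows "zero_ar C X Y \<boxplus> zero_ar C X Y = zero_ar C X Y"
proof -
  interpret H: comm_group "hom_group C X Y"
    using assms by (rule hom_comm_group)
  show ?thesis
    using H.l_one[OF H.one_closed] by (simp add: hom_group_def)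
qed

text \<open>Zero is the only idempotent of a group, so whatever respects sums of arrows also respects
  zero arrows; this is applied to precomposition and to additive functors.\<close>

lemma add_idem_imp_zero:
  assumes "f \<in> homset C X Y" "f \<boxplus> f = f"
  shows "f = zero_ar C X Y"
proof -
  interpret H: comm_group "hom_group C X Y"
    using assms(1) by (intro hom_comm_group homset_source_in homset_target_in)
  show ?thesis
    using H.l_cancel_one[of f f] assms by (simp add: hom_group_def)
qed

lemma zero_comp:
  assumes f: "f \<in> homset C X Y" and Z: "Z \<in> ob C"
  shows "zero_ar C Y Z \<cdot> f = zero_ar C X Z"
proof (rule add_idem_imp_zero)
  have Y: "Y \<in> ob C"
    using f by (rule homset_target_in)
  show "zero_ar C Y Z \<cdot> f \<in> homset C X Z"
    using f zero_in[OF Y Z] by (rule comp_in)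
  show "(zero_ar C Y Z \<cdot> f) \<boxplus> (zero_ar C Y Z \<cdot> f) = zero_ar C Y Z \<cdot> f"
    using comp_add_left[OF f zero_in[OF Y Z] zero_in[OF Y Z]] zero_add_zero[OF Y Z] by simp
qed

end

lemma (in additive_functor) Fa_zero:
  assumes X: "X \<in> ob C" and Y: "Y \<in> ob C"
  shows "Fa (zero_ar C X Y) = zero_ar D (Fo X) (Fo Y)"
proof (rule D.add_idem_imp_zero)
  note Z = C.zero_in[OF X Y]
  show "Fa (zero_ar C X Y) \<in> homset D (Fo X) (Fo Y)"
    using Z by (rule Fa_in)
  show "Fa (zero_ar C X Y) \<boxplus>\<^bsub>D\<^esub> Fa (zero_ar C X Y) = Fa (zero_ar C X Y)"
    using Fa_add[OF Z Z] C.zero_add_zero[OF X Y] by simp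
qed

section \<open>Transport of linear relations along an additive functor\<close>

text \<open>The transport principle behind both axioms: sliding \<open>s\<close> through \<open>T'\<close> replaces it by \<open>F r\<close>,
  which \<open>F \<beta>\<close> annihilates because \<open>F (\<beta> \<circ> r) = F 0 = 0\<close>.  For antisymmetry and for the Jacobi
  identity, \<open>r\<close> and \<open>s\<close> are the sums of permutations in the two categories, and \<open>T = T'\<close> is the
  comparison arrow of the tensor powers.\<close>

lemma (in additive_functor) relation_transport:
  assumes r: "r \<in> homset C X Y" and \<beta>: "\<beta> \<in> homset C Y Z" and rel: "\<beta> \<cdot>\<^bsub>C\<^esub> r = zero_ar C X Z"
    and T: "T \<in> homset D W (Fo X)" and T': "T' \<in> homset D V (Fo Y)" and s: "s \<in> homset D W V"
    and intertwines: "T' \<cdot>\<^bsub>D\<^esub> s = Fa r \<cdot>\<^bsub>D\<^esub> T"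
  shows "(Fa \<beta> \<cdot>\<^bsub>D\<^esub> T') \<cdot>\<^bsub>D\<^esub> s = zero_ar D W (Fo Z)"
proof -
  have X: "X \<in> ob C" and Z: "Z \<in> ob C"
    using C.homset_source_in[OF r] C.homset_target_in[OF \<beta>] .
  have "(Fa \<beta> \<cdot>\<^bsub>D\<^esub> T') \<cdot>\<^bsub>D\<^esub> s = Fa \<beta> \<cdot>\<^bsub>D\<^esub> (Fa r \<cdot>\<^bsub>D\<^esub> T)"
    using D.comp_assoc[OF s T' Fa_in[OF \<beta>]] intertwines by simp
  also have "\<dots> = Fa (\<beta> \<cdot>\<^bsub>C\<^esub> r) \<cdot>\<^bsub>D\<^esub> T"
    using D.comp_assoc[OF T Fa_in[OF r] Fa_in[OF \<beta>]] Fa_comp[OF r \<beta>] by simp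
  also have "\<dots> = zero_ar D W (Fo Z)"
    using rel Fa_zero[OF X Z] D.zero_comp[OF T Fo_in[OF Z]] by simp
  finally show ?thesis .
qed

text \<open>Intertwining is additive, so it need only be checked on the individual permutations.\<close>

lemma (in additive_functor) intertwines_add:
  assumes r: "r \<in> homset C X Y" "r' \<in> homset C X Y"
    and s: "s \<in> homset D W V" "s' \<in> homset D W V"
    and T: "T \<in> homset D W (Fo X)" and T': "T' \<in> homset D V (Fo Y)"
    and "T' \<cdot>\<^bsub>D\<^esub> s = Fa r \<cdot>\<^bsub>D\<^esub> T" "T' \<cdot>\<^bsub>D\<^esub> s' = Fa r' \<cdot>\<^bsub>D\<^esub> T"
  shows "T' \<cdot>\<^bsub>D\<^esub> (s \<boxplus>\<^bsub>D\<^esub> s') = Fa (r \<boxplus>\<^bsub>C\<^esub> r') \<cdot>\<^bsub>D\<^esub> T"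
  using D.comp_add_right[OF s T'] D.comp_add_left[OF T Fa_in[OF r(1)] Fa_in[OF r(2)]] Fa_add[OF r]
    assms(7,8) by simp

lemma (in "functor") intertwines_ide:
  assumes "X \<in> ob C" "T \<in> homset D W (Fo X)"
  shows "T \<cdot>\<^bsub>D\<^esub> ide D W = Fa (ide C X) \<cdot>\<^bsub>D\<^esub> T"
  using assms Fa_ide D.comp_ide D.ide_comp by simp

section \<open>The threefold comparison arrow of a lax monoidal functor\<close>

lemma (in strict_monoidal_category) ide_tensor_comp:
  assumes X: "X \<in> ob C" and f: "f \<in> homset C Y Y'" and g: "g \<in> homset C Y' Y''"
  shows "ide C X \<boxtimes> (g \<cdot> f) = (ide C X \<boxtimes> g) \<cdot> (ide C X \<boxtimes> f)"
  using tensor_comp[OF ide_in[OF X] ide_in[OF X] f g] comp_ide[OF ide_in[OF X]] by simp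

context symmetric_monoidal_functor
begin

text \<open>Naturality of the symmetry of \<open>D\<close> moves it past the inner \<open>\<Psi>\<close>, and its compatibility with
  \<open>\<Psi>\<close> then moves it past the outer one.  The inner \<open>\<Psi>\<close> changes sides in the process, so the two
  bracketings of the threefold comparison arrow occur on the two sides of the equation.\<close>

lemma Psi_symm_tensor_left:
  assumes X: "X \<in> ob C" and Y: "Y \<in> ob C" and Z: "Z \<in> ob C"
  shows "(\<Psi> Z (X \<boxdot>\<^bsub>C\<^esub> Y) \<cdot>\<^bsub>D\<^esub> (ide D (Fo Z) \<boxtimes>\<^bsub>D\<^esub> \<Psi> X Y)) \<cdot>\<^bsub>D\<^esub> symm D (Fo X \<boxdot>\<^bsub>D\<^esub> Fo Y) (Fo Z)
    = Fa (symm C (X \<boxdot>\<^bsub>C\<^esub> Y) Z) \<cdot>\<^bsub>D\<^esub> (\<Psi> (X \<boxdot>\<^bsub>C\<^esub> Y) Z \<cdot>\<^bsub>D\<^esub> (\<Psi> X Y \<boxtimes>\<^bsub>D\<^esub> ide D (Fo Z)))"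
proof -
  note XY = C.tensor_ob_in[OF X Y]
  note FXY = D.tensor_ob_in[OF Fo_in[OF X] Fo_in[OF Y]]
  note idZ = D.ide_in[OF Fo_in[OF Z]]
  note P = Psi_in[OF X Y]
  let ?c = "symm D (Fo X \<boxdot>\<^bsub>D\<^esub> Fo Y) (Fo Z)"
  let ?c' = "symm D (Fo (X \<boxdot>\<^bsub>C\<^esub> Y)) (Fo Z)"
  have "(\<Psi> Z (X \<boxdot>\<^bsub>C\<^esub> Y) \<cdot>\<^bsub>D\<^esub> (ide D (Fo Z) \<boxtimes>\<^bsub>D\<^esub> \<Psi> X Y)) \<cdot>\<^bsub>D\<^esub> ?c
      = \<Psi> Z (X \<boxdot>\<^bsub>C\<^esub> Y) \<cdot>\<^bsub>D\<^esub> ((ide D (Fo Z) \<boxtimes>\<^bsub>D\<^esub> \<Psi> X Y) \<cdot>\<^bsub>D\<^esub> ?c)"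
    by (rule D.comp_assoc[OF D.symm_in[OF FXY Fo_in[OF Z]] D.tensor_ar_in[OF idZ P] Psi_in[OF Z XY]])
  also have "\<dots> = \<Psi> Z (X \<boxdot>\<^bsub>C\<^esub> Y) \<cdot>\<^bsub>D\<^esub> (?c' \<cdot>\<^bsub>D\<^esub> (\<Psi> X Y \<boxtimes>\<^bsub>D\<^esub> ide D (Fo Z)))"
    using D.symm_natural[OF P idZ] by simp
  also have "\<dots> = (\<Psi> Z (X \<boxdot>\<^bsub>C\<^esub> Y) \<cdot>\<^bsub>D\<^esub> ?c') \<cdot>\<^bsub>D\<^esub> (\<Psi> X Y \<boxtimes>\<^bsub>D\<^esub> ide D (Fo Z))"
    using D.comp_assoc[OF D.tensor_ar_in[OF P idZ] D.symm_in[OF Fo_in[OF XY] Fo_in[OF Z]]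
        Psi_in[OF Z XY]] by simp
  also have "\<dots> = (Fa (symm C (X \<boxdot>\<^bsub>C\<^esub> Y) Z) \<cdot>\<^bsub>D\<^esub> \<Psi> (X \<boxdot>\<^bsub>C\<^esub> Y) Z) \<cdot>\<^bsub>D\<^esub> (\<Psi> X Y \<boxtimes>\<^bsub>D\<^esub> ide D (Fo Z))"
    using Psi_symm[OF XY Z] by simp
  also have "\<dots> = Fa (symm C (X \<boxdot>\<^bsub>C\<^esub> Y) Z) \<cdot>\<^bsub>D\<^esub> (\<Psi> (X \<boxdot>\<^bsub>C\<^esub> Y) Z \<cdot>\<^bsub>D\<^esub> (\<Psi> X Y \<boxtimes>\<^bsub>D\<^esub> ide D (Fo Z)))"
    by (rule D.comp_assoc[OF D.tensor_ar_in[OF P idZ] Psi_in[OF XY Z] Fa_in[OF C.symm_in[OF XY Z]]])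
  finally show ?thesis .
qed

lemma Psi_symm_tensor_right:
  assumes X: "X \<in> ob C" and Y: "Y \<in> ob C" and Z: "Z \<in> ob C"
  shows "(\<Psi> (Y \<boxdot>\<^bsub>C\<^esub> Z) X \<cdot>\<^bsub>D\<^esub> (\<Psi> Y Z \<boxtimes>\<^bsub>D\<^esub> ide D (Fo X))) \<cdot>\<^bsub>D\<^esub> symm D (Fo X) (Fo Y \<boxdot>\<^bsub>D\<^esub> Fo Z)
    = Fa (symm C X (Y \<boxdot>\<^bsub>C\<^esub> Z)) \<cdot>\<^bsub>D\<^esub> (\<Psi> X (Y \<boxdot>\<^bsub>C\<^esub> Z) \<cdot>\<^bsub>D\<^esub> (ide D (Fo X) \<boxtimes>\<^bsub>D\<^esub> \<Psi> Y Z))"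
proof -
  note YZ = C.tensor_ob_in[OF Y Z]
  note FYZ = D.tensor_ob_in[OF Fo_in[OF Y] Fo_in[OF Z]]
  note idX = D.ide_in[OF Fo_in[OF X]]
  note P = Psi_in[OF Y Z]
  let ?c = "symm D (Fo X) (Fo Y \<boxdot>\<^bsub>D\<^esub> Fo Z)"
  let ?c' = "symm D (Fo X) (Fo (Y \<boxdot>\<^bsub>C\<^esub> Z))"
  have "(\<Psi> (Y \<boxdot>\<^bsub>C\<^esub> Z) X \<cdot>\<^bsub>D\<^esub> (\<Psi> Y Z \<boxtimes>\<^bsub>D\<^esub> ide D (Fo X))) \<cdot>\<^bsub>D\<^esub> ?c
      = \<Psi> (Y \<boxdot>\<^bsub>C\<^esub> Z) X \<cdot>\<^bsub>D\<^esub> ((\<Psi> Y Z \<boxtimes>\<^bsub>D\<^esub> ide D (Fo X)) \<cdot>\<^bsub>D\<^esub> ?c)"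
    by (rule D.comp_assoc[OF D.symm_in[OF Fo_in[OF X] FYZ] D.tensor_ar_in[OF P idX] Psi_in[OF YZ X]])
  also have "\<dots> = \<Psi> (Y \<boxdot>\<^bsub>C\<^esub> Z) X \<cdot>\<^bsub>D\<^esub> (?c' \<cdot>\<^bsub>D\<^esub> (ide D (Fo X) \<boxtimes>\<^bsub>D\<^esub> \<Psi> Y Z))"
    using D.symm_natural[OF idX P] by simp
  also have "\<dots> = (\<Psi> (Y \<boxdot>\<^bsub>C\<^esub> Z) X \<cdot>\<^bsub>D\<^esub> ?c') \<cdot>\<^bsub>D\<^esub> (ide D (Fo X) \<boxtimes>\<^bsub>D\<^esub> \<Psi> Y Z)"
    using D.comp_assoc[OF D.tensor_ar_in[OF idX P] D.symm_in[OF Fo_in[OF X] Fo_in[OF YZ]]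
        Psi_in[OF YZ X]] by simp
  also have "\<dots> = (Fa (symm C X (Y \<boxdot>\<^bsub>C\<^esub> Z)) \<cdot>\<^bsub>D\<^esub> \<Psi> X (Y \<boxdot>\<^bsub>C\<^esub> Z)) \<cdot>\<^bsub>D\<^esub> (ide D (Fo X) \<boxtimes>\<^bsub>D\<^esub> \<Psi> Y Z)"
    using Psi_symm[OF X YZ] by simp
  also have "\<dots> = Fa (symm C X (Y \<boxdot>\<^bsub>C\<^esub> Z)) \<cdot>\<^bsub>D\<^esub> (\<Psi> X (Y \<boxdot>\<^bsub>C\<^esub> Z) \<cdot>\<^bsub>D\<^esub> (ide D (Fo X) \<boxtimes>\<^bsub>D\<^esub> \<Psi> Y Z))"
    by (rule D.comp_assoc[OF D.tensor_ar_in[OF idX P] Psi_in[OF X YZ] Fa_in[OF C.symm_in[OF X YZ]]])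
  finally show ?thesis .
qed

text \<open>Naturality of \<open>\<Psi>\<close> lets an inner product \<open>F n \<circ> \<Psi>\<close> slide out through the outer \<open>\<Psi>\<close>.  For
  \<open>m = n = br\<close> this expresses the iterated bracket in \<open>D\<close> through the one in \<open>C\<close>.\<close>

lemma iterated_product_factors:
  assumes X: "X \<in> ob C" and Y: "Y \<in> ob C" and Z: "Z \<in> ob C"
    and n: "n \<in> homset C (Y \<boxdot>\<^bsub>C\<^esub> Z) U" and m: "m \<in> homset C (X \<boxdot>\<^bsub>C\<^esub> U) V"
  shows "(Fa m \<cdot>\<^bsub>D\<^esub> \<Psi> X U) \<cdot>\<^bsub>D\<^esub> (ide D (Fo X) \<boxtimes>\<^bsub>D\<^esub> (Fa n \<cdot>\<^bsub>D\<^esub> \<Psi> Y Z))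
    = Fa (m \<cdot>\<^bsub>C\<^esub> (ide C X \<boxtimes>\<^bsub>C\<^esub> n)) \<cdot>\<^bsub>D\<^esub> (\<Psi> X (Y \<boxdot>\<^bsub>C\<^esub> Z) \<cdot>\<^bsub>D\<^esub> (ide D (Fo X) \<boxtimes>\<^bsub>D\<^esub> \<Psi> Y Z))"
proof -
  note YZ = C.tensor_ob_in[OF Y Z]
  note U = C.homset_target_in[OF n]
  note idX = D.ide_in[OF Fo_in[OF X]]
  note P = Psi_in[OF Y Z]
  note in1 = D.tensor_ar_in[OF idX P]
  note in2 = D.tensor_ar_in[OF idX Fa_in[OF n]]
  note n' = C.tensor_ar_in[OF C.ide_in[OF X] n]
  have slide: "\<Psi> X U \<cdot>\<^bsub>D\<^esub> (ide D (Fo X) \<boxtimes>\<^bsub>D\<^esub> Fa n) = Fa (ide C X \<boxtimes>\<^bsub>C\<^esub> n) \<cdot>\<^bsub>D\<^esub> \<Psi> X (Y \<boxdot>\<^bsub>C\<^esub> Z)"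
    using Psi_natural[OF C.ide_in[OF X] n] Fa_ide[OF X] by simp
  have "(Fa m \<cdot>\<^bsub>D\<^esub> \<Psi> X U) \<cdot>\<^bsub>D\<^esub> (ide D (Fo X) \<boxtimes>\<^bsub>D\<^esub> (Fa n \<cdot>\<^bsub>D\<^esub> \<Psi> Y Z))
      = (Fa m \<cdot>\<^bsub>D\<^esub> \<Psi> X U) \<cdot>\<^bsub>D\<^esub> ((ide D (Fo X) \<boxtimes>\<^bsub>D\<^esub> Fa n) \<cdot>\<^bsub>D\<^esub> (ide D (Fo X) \<boxtimes>\<^bsub>D\<^esub> \<Psi> Y Z))"
    using D.ide_tensor_comp[OF Fo_in[OF X] P Fa_in[OF n]] by simp
  also have "\<dots> = Fa m \<cdot>\<^bsub>D\<^esub> ((\<Psi> X U \<cdot>\<^bsub>D\<^esub> (ide D (Fo X) \<boxtimes>\<^bsub>D\<^esub> Fa n)) \<cdot>\<^bsub>D\<^esub> (ide D (Fo X) \<boxtimes>\<^bsub>D\<^esub> \<Psi> Y Z))"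
    using D.comp_assoc[OF D.comp_in[OF in1 in2] Psi_in[OF X U] Fa_in[OF m]]
      D.comp_assoc[OF in1 in2 Psi_in[OF X U]] by simp
  also have "\<dots> = Fa m \<cdot>\<^bsub>D\<^esub> (Fa (ide C X \<boxtimes>\<^bsub>C\<^esub> n)
      \<cdot>\<^bsub>D\<^esub> (\<Psi> X (Y \<boxdot>\<^bsub>C\<^esub> Z) \<cdot>\<^bsub>D\<^esub> (ide D (Fo X) \<boxtimes>\<^bsub>D\<^esub> \<Psi> Y Z)))"
    using slide D.comp_assoc[OF in1 Psi_in[OF X YZ] Fa_in[OF n']] by simp
  also have "\<dots> = Fa (m \<cdot>\<^bsub>C\<^esub> (ide C X \<boxtimes>\<^bsub>C\<^esub> n))
      \<cdot>\<^bsub>D\<^esub> (\<Psi> X (Y \<boxdot>\<^bsub>C\<^esub> Z) \<cdot>\<^bsub>D\<^esub> (ide D (Fo X) \<boxtimes>\<^bsub>D\<^esub> \<Psi> Y Z))"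
    using D.comp_assoc[OF D.comp_in[OF in1 Psi_in[OF X YZ]] Fa_in[OF n'] Fa_in[OF m]]
      Fa_comp[OF n' m] by simp
  finally show ?thesis .
qed

end

section \<open>Images of Lie algebras\<close>

theorem corollary3p5:
  fixes C :: "('o, 'a, 'm) monoidal_data_scheme"
    and D :: "('p, 'b, 'n) monoidal_data_scheme"
    and Fo :: "'o \<Rightarrow> 'p" and Fa :: "'a \<Rightarrow> 'b"
    and \<Psi>\<^sub>0 :: 'b and \<Psi> :: "'o \<Rightarrow> 'o \<Rightarrow> 'b"
    and L :: 'o and br :: 'a
  assumes "additive_symmetric_strict_monoidal_category C"
    and "additive_symmetric_strict_monoidal_category D"
    and "additive_symmetric_monoidal_functor C D Fo Fa \<Psi>\<^sub>0 \<Psi>"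
    and "lie_algebra C L br"
  shows "lie_algebra D (Fo L) (Fa br \<cdot>\<^bsub>D\<^esub> \<Psi> L L)"
proof -
  interpret C: additive_symmetric_strict_monoidal_category C by fact
  interpret D: additive_symmetric_strict_monoidal_category D by fact
  interpret F: additive_symmetric_monoidal_functor C D Fo Fa \<Psi>\<^sub>0 \<Psi> by fact
  interpret L: lie_algebra C L br by fact
  note L = L.L_in and br = L.br_in
  note LL = C.tensor_ob_in[OF L L]
  note LLL = C.tensor_ob_in[OF L LL]
  note FL = F.Fo_in[OF L]
  note FLL = D.tensor_ob_in[OF FL FL]
  note FLLL = D.tensor_ob_in[OF FL FLL]
  note idFL = D.ide_in[OF FL]
  let ?b = "Fa br \<cdot>\<^bsub>D\<^esub> \<Psi> L L"
  let ?T = "\<Psi> L (L \<boxdot>\<^bsub>C\<^esub> L) \<cdot>\<^bsub>D\<^esub> (ide D (Fo L) \<boxtimes>\<^bsub>D\<^esub> \<Psi> L L)"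
  let ?LL = "L \<boxdot>\<^bsub>C\<^esub> L" and ?LLL = "L \<boxdot>\<^bsub>C\<^esub> L \<boxdot>\<^bsub>C\<^esub> L"
  let ?FLL = "Fo L \<boxdot>\<^bsub>D\<^esub> Fo L" and ?FLLL = "Fo L \<boxdot>\<^bsub>D\<^esub> Fo L \<boxdot>\<^bsub>D\<^esub> Fo L"
  have P: "\<Psi> L L \<in> homset D ?FLL (Fo ?LL)"
    by (rule F.Psi_in[OF L L])
  have T: "?T \<in> homset D ?FLLL (Fo ?LLL)"
    by (rule D.comp_in[OF D.tensor_ar_in[OF idFL P] F.Psi_in[OF L LL]])
  have b: "?b \<in> homset D ?FLL (Fo L)"
    by (rule D.comp_in[OF P F.Fa_in[OF br]])

  have antisymmetry: "?b \<cdot>\<^bsub>D\<^esub> (ide D ?FLL \<boxplus>\<^bsub>D\<^esub> symm D (Fo L) (Fo L)) = zero_ar D ?FLL (Fo L)"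
  proof (rule F.relation_transport[OF _ br L.antisymmetry P P])
    show "\<Psi> L L \<cdot>\<^bsub>D\<^esub> (ide D ?FLL \<boxplus>\<^bsub>D\<^esub> symm D (Fo L) (Fo L))
        = Fa (ide C ?LL \<boxplus>\<^bsub>C\<^esub> symm C L L) \<cdot>\<^bsub>D\<^esub> \<Psi> L L"
      by (rule F.intertwines_add[OF C.ide_in[OF LL] C.symm_in[OF L L] D.ide_in[OF FLL]
            D.symm_in[OF FL FL] P P F.intertwines_ide[OF LL P] F.Psi_symm[OF L L]])
  qed (intro C.add_in D.add_in C.ide_in D.ide_in C.symm_in D.symm_in L LL FL FLL)+

  \<comment> \<open>By strictness the block symmetries are endomorphisms of the threefold tensor power.\<close>
  have t: "symm C ?LL L \<in> homset C ?LLL ?LLL" and w: "symm C L ?LL \<in> homset C ?LLL ?LLL"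
    using C.symm_in[OF LL L] C.symm_in[OF L LL] C.tensor_ob_assoc[OF L L L] by simp_all
  have t': "symm D ?FLL (Fo L) \<in> homset D ?FLLL ?FLLL"
    and w': "symm D (Fo L) ?FLL \<in> homset D ?FLLL ?FLLL"
    using D.symm_in[OF FLL FL] D.symm_in[OF FL FLL] D.tensor_ob_assoc[OF FL FL FL] by simp_all
  note idLLL = C.ide_in[OF LLL] and idFLLL = D.ide_in[OF FLLL]

  have Tt: "?T \<cdot>\<^bsub>D\<^esub> symm D ?FLL (Fo L) = Fa (symm C ?LL L) \<cdot>\<^bsub>D\<^esub> ?T"
    using F.Psi_symm_tensor_left[OF L L L] F.Psi_assoc[OF L L L] by simp
  have Tw: "?T \<cdot>\<^bsub>D\<^esub> symm D (Fo L) ?FLL = Fa (symm C L ?LL) \<cdot>\<^bsub>D\<^esub> ?T"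
    using F.Psi_symm_tensor_right[OF L L L] F.Psi_assoc[OF L L L] by simp

  let ?r = "ide C ?LLL \<boxplus>\<^bsub>C\<^esub> symm C ?LL L \<boxplus>\<^bsub>C\<^esub> symm C L ?LL"
  let ?s = "ide D ?FLLL \<boxplus>\<^bsub>D\<^esub> symm D ?FLL (Fo L) \<boxplus>\<^bsub>D\<^esub> symm D (Fo L) ?FLL"
  have r: "?r \<in> homset C ?LLL ?LLL"
    by (intro C.add_in idLLL t w)
  have s: "?s \<in> homset D ?FLLL ?FLLL"
    by (intro D.add_in idFLLL t' w')
  have Tr: "?T \<cdot>\<^bsub>D\<^esub> ?s = Fa ?r \<cdot>\<^bsub>D\<^esub> ?T"
    by (rule F.intertwines_add[OF C.add_in[OF idLLL t] w D.add_in[OF idFLLL t'] w' T T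
          F.intertwines_add[OF idLLL t idFLLL t' T T F.intertwines_ide[OF LLL T] Tt] Tw])

  note idbr = C.tensor_ar_in[OF C.ide_in[OF L] br]
  note \<beta> = C.comp_in[OF idbr br]
  have rel: "(br \<cdot>\<^bsub>C\<^esub> (ide C L \<boxtimes>\<^bsub>C\<^esub> br)) \<cdot>\<^bsub>C\<^esub> ?r = zero_ar C ?LLL L"
    using C.comp_assoc[OF r idbr br] L.jacobi by simp
  have "?b \<cdot>\<^bsub>D\<^esub> (ide D (Fo L) \<boxtimes>\<^bsub>D\<^esub> ?b) \<cdot>\<^bsub>D\<^esub> ?s = (?b \<cdot>\<^bsub>D\<^esub> (ide D (Fo L) \<boxtimes>\<^bsub>D\<^esub> ?b)) \<cdot>\<^bsub>D\<^esub> ?s"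
    using D.comp_assoc[OF s D.tensor_ar_in[OF idFL b] b] by simp
  also have "\<dots> = (Fa (br \<cdot>\<^bsub>C\<^esub> (ide C L \<boxtimes>\<^bsub>C\<^esub> br)) \<cdot>\<^bsub>D\<^esub> ?T) \<cdot>\<^bsub>D\<^esub> ?s"
    using F.iterated_product_factors[OF L L L br br] by simp
  also have "\<dots> = zero_ar D ?FLLL (Fo L)"
    by (rule F.relation_transport[OF r \<beta> rel T T s Tr])
  finally have jacobi:
    "?b \<cdot>\<^bsub>D\<^esub> (ide D (Fo L) \<boxtimes>\<^bsub>D\<^esub> ?b) \<cdot>\<^bsub>D\<^esub> ?s = zero_ar D ?FLLL (Fo L)" .

  show ?thesis
    by unfold_locales (fact FL b antisymmetry jacobi)+
qed

end
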